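(* Let $n\ge 1$, let $U\in \mathrm{SU}(2^n)$, and suppose that $\theta_U:\mathfrak{su}(2^n)\to\mathfrak{su}(2^n)$, $\theta_U(g):=UgU^\dagger$, is such that $(\mathfrak{su}(2^n),\theta_U)$ is an orthogonal symmetric Lie algebra, with $-1$ eigenspace $\mathfrak{m}$. Let $\Theta(G):=UGU^\dagger$ for $G\in\mathrm{SU}(2^n)$. Let $G\in \mathrm{SU}(2^n)$ be such that $\Theta(G^\dagger)G$ has no negative real eigenvalues. Then $$m:=\tfrac12\log\bigl(\Theta(G^\dagger)\,G\bigr),$$ where $\log$ is the principal matrix logarithm, lies in $\mathfrak{m}$ and satisfies $$\exp(2m)=\Theta(G^\dagger)\,G .$$
   Context: $\mathfrak{su}(2^n)$ is the real Lie algebra of traceless skew-Hermitian $2^n\times 2^n$ complex matrices and $\dagger$ is the conjugate transpose. A pair $(\mathfrak{g},\theta)$ is an orthogonal symmetric Lie algebra if $\theta$ is an involutive automorphism of the real Lie algebra $\mathfrak{g}$ ($\theta\ne\mathrm{id}$, $\theta^2=\mathrm{id}$) whose fixed-point set is a compactly embedded subalgebra (automatic when $\mathfrak{g}$ is compact semisimple). Its $+1$ and $-1$ eigenspaces are denoted $\mathfrak{k}$ and $\mathfrak{m}$. The principal logarithm of a unitary matrix $W$ without eigenvalue $-1$ is the matrix with the same spectral decomposition as $W$ in which each eigenvalue $e^{it}$, $t\in(-\pi,\pi)$, is replaced by $it$. *)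

theory Defs
  imports
    "HOL-Analysis.Function_Topology"
    "Jordan_Normal_Form.Schur_Decomposition"
begin

definition mat_trace :: "complex mat \<Rightarrow> complex" where
  "mat_trace A = (\<Sum>i<dim_row A. A $$ (i, i))"

definition unitary_group :: "nat \<Rightarrow> complex mat set" where
  "unitary_group N = {U \<in> carrier_mat N N. U * mat_adjoint U = 1\<^sub>m N \<and> mat_adjoint U * U = 1\<^sub>m N}"

definition SU :: "nat \<Rightarrow> complex mat set" where
  "SU N = {U \<in> unitary_group N. det U = 1}"

definition su :: "nat \<Rightarrow> complex mat set" where
  "su N = {A \<in> carrier_mat N N. mat_adjoint A = - A \<and> mat_trace A = 0}"

text \<open>
  Real Lie algebras are represented as real subspaces of the complex \<open>N \<times> N\<close> matrices
  that are closed under the commutator. In \<open>complex_of_real c \<cdot>\<^sub>m A\<close> the scalar is real.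
\<close>

definition lie_bracket :: "complex mat \<Rightarrow> complex mat \<Rightarrow> complex mat" where
  "lie_bracket A B = A * B - B * A"

definition real_lie_algebra :: "nat \<Rightarrow> complex mat set \<Rightarrow> bool" where
  "real_lie_algebra N \<gg> \<longleftrightarrow>
     \<gg> \<subseteq> carrier_mat N N \<and> 0\<^sub>m N N \<in> \<gg> \<and>
     (\<forall>A\<in>\<gg>. \<forall>B\<in>\<gg>. A + B \<in> \<gg>) \<and>
     (\<forall>c::real. \<forall>A\<in>\<gg>. complex_of_real c \<cdot>\<^sub>m A \<in> \<gg>) \<and>
     (\<forall>A\<in>\<gg>. \<forall>B\<in>\<gg>. lie_bracket A B \<in> \<gg>)"

definition lie_automorphism :: "complex mat set \<Rightarrow> (complex mat \<Rightarrow> complex mat) \<Rightarrow> bool" where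
  "lie_automorphism \<gg> \<theta> \<longleftrightarrow>
     bij_betw \<theta> \<gg> \<gg> \<and>
     (\<forall>A\<in>\<gg>. \<forall>B\<in>\<gg>. \<theta> (A + B) = \<theta> A + \<theta> B) \<and>
     (\<forall>c::real. \<forall>A\<in>\<gg>. \<theta> (complex_of_real c \<cdot>\<^sub>m A) = complex_of_real c \<cdot>\<^sub>m \<theta> A) \<and>
     (\<forall>A\<in>\<gg>. \<forall>B\<in>\<gg>. \<theta> (lie_bracket A B) = lie_bracket (\<theta> A) (\<theta> B))"

definition involutive_on :: "complex mat set \<Rightarrow> (complex mat \<Rightarrow> complex mat) \<Rightarrow> bool" where
  "involutive_on \<gg> \<theta> \<longleftrightarrow> (\<forall>A\<in>\<gg>. \<theta> (\<theta> A) = A) \<and> (\<exists>A\<in>\<gg>. \<theta> A \<noteq> A)"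

definition plus_eigenspace :: "complex mat set \<Rightarrow> (complex mat \<Rightarrow> complex mat) \<Rightarrow> complex mat set" where
  "plus_eigenspace \<gg> \<theta> = {A \<in> \<gg>. \<theta> A = A}"

definition minus_eigenspace :: "complex mat set \<Rightarrow> (complex mat \<Rightarrow> complex mat) \<Rightarrow> complex mat set" where
  "minus_eigenspace \<gg> \<theta> = {A \<in> \<gg>. \<theta> A = - A}"

text \<open>
  A subalgebra \<open>\<kk>\<close> of \<open>\<gg>\<close> is compactly embedded if the connected Lie subgroup of \<open>GL(\<gg>)\<close>
  with Lie algebra \<open>ad(\<kk>)\<close> is compact. This subgroup is generated by the maps
  \<open>exp(ad X)\<close> with \<open>X \<in> \<kk>\<close>; since \<open>\<kk>\<close> is closed under negation, the generated monoid
  is already a group.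
\<close>

definition exp_ad :: "nat \<Rightarrow> complex mat \<Rightarrow> complex mat \<Rightarrow> complex mat" where
  "exp_ad N X Y = mat N N (\<lambda>(i, j). \<Sum>k. ((lie_bracket X ^^ k) Y) $$ (i, j) / fact k)"

inductive_set ad_group :: "nat \<Rightarrow> complex mat set \<Rightarrow> (complex mat \<Rightarrow> complex mat) set"
  for N :: nat and \<kk> :: "complex mat set" where
  ad_group_id: "id \<in> ad_group N \<kk>"
| ad_group_comp: "X \<in> \<kk> \<Longrightarrow> f \<in> ad_group N \<kk> \<Longrightarrow> exp_ad N X \<circ> f \<in> ad_group N \<kk>"

text \<open>
  The matrix type carries no topology, so a linear endomorphism \<open>f\<close> of \<open>\<gg>\<close> is identified with
  the family of entries of the matrices \<open>f Y\<close>, \<open>Y \<in> \<gg>\<close>. The product topology on such families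
  is the topology of pointwise convergence, which on the endomorphisms of the
  finite-dimensional space \<open>\<gg>\<close> is the usual one.
\<close>

definition endo_entries ::
  "nat \<Rightarrow> complex mat set \<Rightarrow> (complex mat \<Rightarrow> complex mat) \<Rightarrow> complex mat \<times> nat \<times> nat \<Rightarrow> complex" where
  "endo_entries N \<gg> f = (\<lambda>(Y, i, j). if Y \<in> \<gg> \<and> i < N \<and> j < N then f Y $$ (i, j) else 0)"

definition compactly_embedded :: "nat \<Rightarrow> complex mat set \<Rightarrow> complex mat set \<Rightarrow> bool" where
  "compactly_embedded N \<gg> \<kk> \<longleftrightarrow>
     real_lie_algebra N \<kk> \<and> \<kk> \<subseteq> \<gg> \<and> compact (endo_entries N \<gg> ` ad_group N \<kk>)"

definition orthogonal_symmetric_lie_algebra ::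
  "nat \<Rightarrow> complex mat set \<Rightarrow> (complex mat \<Rightarrow> complex mat) \<Rightarrow> bool" where
  "orthogonal_symmetric_lie_algebra N \<gg> \<theta> \<longleftrightarrow>
     real_lie_algebra N \<gg> \<and> lie_automorphism \<gg> \<theta> \<and> involutive_on \<gg> \<theta> \<and>
     compactly_embedded N \<gg> (plus_eigenspace \<gg> \<theta>)"

definition conj_by :: "complex mat \<Rightarrow> complex mat \<Rightarrow> complex mat" where
  "conj_by U A = U * A * mat_adjoint U"

definition mat_exp :: "complex mat \<Rightarrow> complex mat" where
  "mat_exp A = mat (dim_row A) (dim_row A) (\<lambda>(i, j). \<Sum>k. (A ^\<^sub>m k) $$ (i, j) / fact k)"

text \<open>
  The columns of \<open>V\<close> below form an orthonormal eigenbasis of \<open>W\<close> with eigenvalues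
  \<open>exp (\<i> * t j)\<close>. For unitary \<open>W\<close> without eigenvalue \<open>-1\<close> such \<open>V\<close>, \<open>t\<close> exist and \<open>L\<close> does not
  depend on their choice.
\<close>

definition principal_log :: "complex mat \<Rightarrow> complex mat" where
  "principal_log W = (THE L. \<exists>V (t :: nat \<Rightarrow> real).
     V \<in> unitary_group (dim_row W) \<and>
     (\<forall>j<dim_row W. - pi < t j \<and> t j < pi) \<and>
     W = V * mat_diag (dim_row W) (\<lambda>j. exp (\<i> * t j)) * mat_adjoint V \<and>
     L = V * mat_diag (dim_row W) (\<lambda>j. \<i> * t j) * mat_adjoint V)"

end

theory Submission
  imports Defs "Jordan_Normal_Form.Spectral_Radius"
begin

text \<open>
  Since \<open>\<theta>\<^sub>U\<close> is an involution, \<open>U\<^sup>2\<close> commutes with \<open>su N\<close>, hence with every matrix, so that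
  \<open>W = \<Theta>(G\<^sup>\<dagger>) G\<close> satisfies \<open>U W U\<^sup>\<dagger> = W\<^sup>\<dagger>\<close>. The principal logarithm is equivariant under conjugation and
  turns \<open>W\<^sup>\<dagger>\<close> into \<open>- log W\<close>, which gives \<open>U (log W) U\<^sup>\<dagger> = - log W\<close>. As conjugation preserves the
  trace, \<open>log W\<close> is traceless; \<open>det W = 1\<close> alone would only give a trace in \<open>2\<pi>\<i>\<int>\<close>.
\<close>

section \<open>Adjoints and unitary matrices\<close>

lemma mat_adjoint_carrier [simp]:
  "A \<in> carrier_mat n m \<Longrightarrow> mat_adjoint A \<in> carrier_mat m n"
  by (auto simp: mat_adjoint_def mat_of_rows_def)

lemma dim_mat_adjoint [simp]:
  "dim_row (mat_adjoint A) = dim_col A" "dim_col (mat_adjoint A) = dim_row A"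
  by (auto simp: mat_adjoint_def mat_of_rows_def)

lemma index_mat_adjoint [simp]:
  "i < dim_col A \<Longrightarrow> j < dim_row A \<Longrightarrow> mat_adjoint (A :: complex mat) $$ (i, j) = cnj (A $$ (j, i))"
  by (auto simp: mat_adjoint_def mat_of_rows_index)

lemma mat_adjoint_adjoint [simp]: "mat_adjoint (mat_adjoint A) = (A :: complex mat)"
  by (rule eq_matI) auto

lemma mat_adjoint_mult:
  fixes A B :: "complex mat"
  assumes "A \<in> carrier_mat n m" "B \<in> carrier_mat m k"
  shows "mat_adjoint (A * B) = mat_adjoint B * mat_adjoint A"
  using assms by (intro eq_matI) (auto simp: scalar_prod_def mult.commute)

lemma square_mult_carrier [simp]:
  "A \<in> carrier_mat n n \<Longrightarrow> B \<in> carrier_mat n n \<Longrightarrow> A * B \<in> carrier_mat n n"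
  by (rule mult_carrier_mat)

lemma mat_trace_comm:
  assumes "A \<in> carrier_mat n n" "B \<in> carrier_mat n n"
  shows "mat_trace (A * B) = mat_trace (B * A)"
proof -
  have "mat_trace (A * B) = (\<Sum>i<n. \<Sum>j<n. A $$ (i, j) * B $$ (j, i))"
    using assms by (simp add: mat_trace_def scalar_prod_def lessThan_atLeast0)
  also have "\<dots> = (\<Sum>j<n. \<Sum>i<n. B $$ (j, i) * A $$ (i, j))"
    by (subst sum.swap) (simp add: mult.commute)
  also have "\<dots> = mat_trace (B * A)"
    using assms by (simp add: mat_trace_def scalar_prod_def lessThan_atLeast0)
  finally show ?thesis .
qed

lemma unitary_groupD:
  assumes "U \<in> unitary_group N"
  shows "U \<in> carrier_mat N N" "U * mat_adjoint U = 1\<^sub>m N" "mat_adjoint U * U = 1\<^sub>m N"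
  using assms by (auto simp: unitary_group_def)

text \<open>A one-sided inverse of a square matrix is two-sided, so a single product suffices to
  establish unitarity.\<close>

lemma unitary_groupI:
  assumes "U \<in> carrier_mat N N" "mat_adjoint U * U = 1\<^sub>m N"
  shows "U \<in> unitary_group N"
  using assms mat_mult_left_right_inverse[of "mat_adjoint U" N U]
  by (auto simp: unitary_group_def)

text \<open>Stated in right-nested form, so that it applies as a rewrite rule after
  \<open>assoc_mult_mat\<close> has normalised a product.\<close>

lemma unitary_cancel:
  assumes "U \<in> unitary_group N" "A \<in> carrier_mat N m"
  shows "mat_adjoint U * (U * A) = A" "U * (mat_adjoint U * A) = A"
proof -
  note U = unitary_groupD[OF assms(1)]
  show "mat_adjoint U * (U * A) = A" "U * (mat_adjoint U * A) = A"
    using assms(2) U(1) by (simp_all add: U(2,3) flip: assoc_mult_mat[of _ N N _ N _ m])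
qed

lemma unitary_group_adjoint: "U \<in> unitary_group N \<Longrightarrow> mat_adjoint U \<in> unitary_group N"
  by (auto simp: unitary_group_def)

lemma unitary_group_one: "1\<^sub>m N \<in> unitary_group N"
proof (rule unitary_groupI)
  have "mat_adjoint (1\<^sub>m N) = (1\<^sub>m N :: complex mat)"
    by (rule eq_matI) auto
  then show "mat_adjoint (1\<^sub>m N) * 1\<^sub>m N = (1\<^sub>m N :: complex mat)"
    by simp
qed simp

lemma unitary_group_mult:
  assumes "U \<in> unitary_group N" "V \<in> unitary_group N"
  shows "U * V \<in> unitary_group N"
proof (rule unitary_groupI)
  note U = unitary_groupD[OF assms(1)] and V = unitary_groupD[OF assms(2)]
  show "U * V \<in> carrier_mat N N"
    using U(1) V(1) by simp
  show "mat_adjoint (U * V) * (U * V) = 1\<^sub>m N"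
    using U(1) V(1) V(3) unitary_cancel(1)[OF assms(1), of V N]
    by (simp add: mat_adjoint_mult[of _ N N _ N] assoc_mult_mat[of _ N N _ N _ N])
qed

section \<open>Unitary diagonalisation\<close>

text \<open>Gram--Schmidt in the library yields orthogonal vectors of arbitrary length, so the columns
  still have to be normalised.\<close>

lemma unitary_extending_vec:
  fixes v :: "complex vec"
  assumes v: "v \<in> carrier_vec n" and v0: "v \<noteq> 0\<^sub>v n"
  obtains V c where "V \<in> unitary_group n" "col V 0 = c \<cdot>\<^sub>v v" "c \<noteq> 0"
proof -
  interpret cof_vec_space n "TYPE(complex)" .
  define ws where "ws = gram_schmidt n (basis_completion v)"
  note b = basis_completion[OF v v0]
  have len: "length ws = n" and ws: "set ws \<subseteq> carrier_vec n" and orth: "corthogonal ws"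
    using gram_schmidt_result[OF b(2,4,5) refl] b(6) by (auto simp: ws_def)
  have n0: "n > 0"
    using v v0 by (cases n) auto
  \<comment> \<open>The completed basis starts with \<open>v\<close>, and Gram-Schmidt leaves its
    first vector unchanged.\<close>
  have hd: "ws ! 0 = v"
  proof -
    obtain vs where "basis_completion v = v # vs"
      using b(6,7) n0 by (cases "basis_completion v") auto
    then have "hd ws = v"
      unfolding ws_def by (simp only: gram_schmidt_hd[OF v])
    then show ?thesis
      using len n0 by (metis hd_conv_nth length_greater_0_conv)
  qed
  have wsi: "ws ! i \<in> carrier_vec n" if "i < n" for i
    using that len ws by auto
  define r where "r i = sqrt (\<Sum>k<n. (cmod (ws ! i $ k))\<^sup>2)" for i
  have sq: "(\<Sum>k<n. ws ! i $ k * cnj (ws ! i $ k)) = complex_of_real ((r i)\<^sup>2)" for i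
    by (simp add: r_def sum_nonneg complex_mult_cnj cmod_power2)
  have ip: "(ws ! i \<bullet>c ws ! j) = (\<Sum>k<n. ws ! i $ k * cnj (ws ! j $ k))" if "i < n" "j < n" for i j
    using wsi[OF that(1)] wsi[OF that(2)] by (simp add: scalar_prod_def lessThan_atLeast0)
  have off: "(\<Sum>k<n. ws ! i $ k * cnj (ws ! j $ k)) = 0" if "i < n" "j < n" "i \<noteq> j" for i j
    using corthogonalD[OF orth, of i j] that ip[of i j] len by auto
  \<comment> \<open>\<open>corthogonal\<close> says that inner products vanish exactly for distinct
    indices, so the diagonal case yields nonzero lengths.\<close>
  have r0: "r i \<noteq> 0" if "i < n" for i
    using corthogonalD[OF orth, of i i] that ip[of i i] len sq[of i] by auto
  define V where "V = mat n n (\<lambda>(i, j). ws ! j $ i / complex_of_real (r j))"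
  have V: "V \<in> carrier_mat n n"
    by (simp add: V_def)
  have "mat_adjoint V * V = 1\<^sub>m n"
  proof (rule eq_matI)
    fix i j assume "i < dim_row (1\<^sub>m n :: complex mat)" "j < dim_col (1\<^sub>m n :: complex mat)"
    then have ij: "i < n" "j < n"
      by auto
    have "(mat_adjoint V * V) $$ (i, j) = (\<Sum>k<n. cnj (V $$ (k, i)) * V $$ (k, j))"
      using ij V by (simp add: scalar_prod_def lessThan_atLeast0)
    also have "\<dots> = (\<Sum>k<n. (ws ! j $ k * cnj (ws ! i $ k)) / complex_of_real (r i * r j))"
      using ij by (intro sum.cong) (auto simp: V_def)
    also have "\<dots> = (\<Sum>k<n. ws ! j $ k * cnj (ws ! i $ k)) / complex_of_real (r i * r j)"
      by (simp add: sum_divide_distrib)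
    also have "\<dots> = 1\<^sub>m n $$ (i, j)"
      using ij off[of j i] sq[of i] r0[of i] by (auto simp: power2_eq_square)
    finally show "(mat_adjoint V * V) $$ (i, j) = 1\<^sub>m n $$ (i, j)" .
  qed (use V in auto)
  then have "V \<in> unitary_group n"
    using V by (intro unitary_groupI)
  moreover have "col V 0 = (1 / complex_of_real (r 0)) \<cdot>\<^sub>v v"
    using v n0 by (intro eq_vecI) (auto simp: V_def hd)
  ultimately show ?thesis
    using r0[of 0] n0 by (intro that[of V "1 / complex_of_real (r 0)"]) auto
qed

section \<open>Direct sum of a scalar and a matrix, for the induction on dimension\<close>

definition border :: "complex \<Rightarrow> complex mat \<Rightarrow> complex mat" where
  "border a A = four_block_mat (mat 1 1 (\<lambda>_. a)) (0\<^sub>m 1 (dim_col A)) (0\<^sub>m (dim_row A) 1) A"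

lemma dim_border [simp]:
  "dim_row (border a A) = Suc (dim_row A)" "dim_col (border a A) = Suc (dim_col A)"
  by (auto simp: border_def)

lemma border_carrier: "A \<in> carrier_mat n m \<Longrightarrow> border a A \<in> carrier_mat (Suc n) (Suc m)"
  by (metis carrier_matD carrier_matI dim_border)

lemma index_border:
  "i < Suc (dim_row A) \<Longrightarrow> j < Suc (dim_col A) \<Longrightarrow>
   border a A $$ (i, j) = (if i = 0 then if j = 0 then a else 0 else if j = 0 then 0 else A $$ (i - 1, j - 1))"
  by (auto simp: border_def)

lemma border_mult:
  assumes "A \<in> carrier_mat n n" "B \<in> carrier_mat n n"
  shows "border a A * border b B = border (a * b) (A * B)"
proof (rule eq_matI)
  fix i j assume "i < dim_row (border (a * b) (A * B))" "j < dim_col (border (a * b) (A * B))"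
  then have ij: "i < Suc n" "j < Suc n"
    using assms by auto
  have "(border a A * border b B) $$ (i, j) = (\<Sum>k<Suc n. border a A $$ (i, k) * border b B $$ (k, j))"
    using ij assms by (simp add: scalar_prod_def lessThan_atLeast0 del: sum.op_ivl_Suc)
  also have "\<dots> = border (a * b) (A * B) $$ (i, j)"
    \<comment> \<open>Splitting off \<open>k = 0\<close> separates the scalar block; the shifted
      remainder is the product of the lower blocks.\<close>
    unfolding sum.lessThan_Suc_shift using ij assms
    by (cases i; cases j) (auto simp: index_border scalar_prod_def lessThan_atLeast0)
  finally show "(border a A * border b B) $$ (i, j) = border (a * b) (A * B) $$ (i, j)" .
qed (use assms in auto)

lemma border_adjoint: "mat_adjoint (border a A) = border (cnj a) (mat_adjoint A)"
  by (rule eq_matI) (auto simp: index_border)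

lemma border_one: "border 1 (1\<^sub>m n) = 1\<^sub>m (Suc n)"
  by (rule eq_matI) (auto simp: index_border)

lemma border_inject:
  assumes "border a A = border b B"
  shows "A = B"
proof -
  have dims: "dim_row A = dim_row B" "dim_col A = dim_col B"
    using arg_cong[OF assms, of dim_row] arg_cong[OF assms, of dim_col] by auto
  show ?thesis
  proof (rule eq_matI)
    fix i j assume "i < dim_row B" "j < dim_col B"
    then show "A $$ (i, j) = B $$ (i, j)"
      using arg_cong[OF assms, of "\<lambda>M. M $$ (Suc i, Suc j)"] dims by (simp add: index_border)
  qed (use dims in auto)
qed

lemma border_mat_diag: "border a (mat_diag n d) = mat_diag (Suc n) (case_nat a d)"
  by (rule eq_matI) (auto simp: index_border mat_diag_def split: nat.split)

text \<open>Serves both directions of the induction: left to right for passing to the smaller block,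
  right to left for extending its diagonalising matrix.\<close>

lemma unitary_group_border_iff:
  assumes "A \<in> carrier_mat n n"
  shows "border a A \<in> unitary_group (Suc n) \<longleftrightarrow> cnj a * a = 1 \<and> A \<in> unitary_group n"
proof -
  have eq: "mat_adjoint (border a A) * border a A = border (cnj a * a) (mat_adjoint A * A)"
    using assms by (simp add: border_adjoint border_mult[of _ n])
  show ?thesis
  proof
    assume "border a A \<in> unitary_group (Suc n)"
    then have *: "border (cnj a * a) (mat_adjoint A * A) = border 1 (1\<^sub>m n)"
      using unitary_groupD(3) eq by (metis border_one)
    have "cnj a * a = 1"
      using arg_cong[OF *, of "\<lambda>M. M $$ (0, 0)"] by (simp add: index_border del: index_mult_mat)
    moreover have "mat_adjoint A * A = 1\<^sub>m n"
      using * by (rule border_inject)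
    ultimately show "cnj a * a = 1 \<and> A \<in> unitary_group n"
      using assms unitary_groupI by blast
  next
    assume "cnj a * a = 1 \<and> A \<in> unitary_group n"
    then show "border a A \<in> unitary_group (Suc n)"
      using eq assms by (intro unitary_groupI) (simp_all add: unitary_groupD(3)[of A n] border_one border_carrier)
  qed
qed

text \<open>Induction on the dimension. In an orthonormal basis starting with an eigenvector, the
  first column is \<open>\<mu>\<close> followed by zeros. Unitarity then clears the rest of the
  first row, which leaves a direct sum of \<open>\<mu>\<close> and a smaller unitary matrix.\<close>

theorem unitary_diagonalisation:
  assumes "W \<in> unitary_group n"
  obtains V d where "V \<in> unitary_group n" "W = V * mat_diag n d * mat_adjoint V"
  using assms
proof (induction n arbitrary: W thesis)
  case 0
  show ?case
    by (rule "0.prems"(1)[OF unitary_group_one, of "\<lambda>_. 0"])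
       (use "0.prems"(2) in \<open>auto simp: unitary_group_def intro!: eq_matI\<close>)
next
  case (Suc n)
  let ?n = "Suc n"
  note W = unitary_groupD[OF Suc.prems(2)]
  obtain \<mu> v where v: "v \<in> carrier_vec ?n" "v \<noteq> 0\<^sub>v ?n" and ev: "W *\<^sub>v v = \<mu> \<cdot>\<^sub>v v"
    using spectrum_non_empty[OF W(1)] W(1)
    by (auto simp: spectrum_def eigenvalue_def eigenvector_def)
  obtain Q c where Q: "Q \<in> unitary_group ?n" and Q0: "col Q 0 = c \<cdot>\<^sub>v v"
    using unitary_extending_vec[OF v] by metis
  note Qc = unitary_groupD[OF Q]
  define M where "M = mat_adjoint Q * W * Q"
  have M: "M \<in> unitary_group ?n"
    unfolding M_def by (intro unitary_group_mult unitary_group_adjoint Q Suc.prems)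
  note Mc = unitary_groupD[OF M]
  \<comment> \<open>The first column of \<open>Q\<close> is an eigenvector of \<open>W\<close>, and
    the columns of \<open>Q\<close> are orthonormal.\<close>
  have col0: "M $$ (i, 0) = (if i = 0 then \<mu> else 0)" if "i < ?n" for i
  proof -
    have "col (W * Q) 0 = W *\<^sub>v (c \<cdot>\<^sub>v v)"
      by (simp only: col_mult2[OF W(1) Qc(1) zero_less_Suc] Q0)
    also have "\<dots> = c \<cdot>\<^sub>v (\<mu> \<cdot>\<^sub>v v)"
      unfolding mult_mat_vec[OF W(1) v(1)] ev ..
    also have "\<dots> = \<mu> \<cdot>\<^sub>v col Q 0"
      by (simp add: Q0 smult_smult_assoc mult.commute)
    finally have "col (W * Q) 0 = \<mu> \<cdot>\<^sub>v col Q 0" .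
    then have "M $$ (i, 0) = row (mat_adjoint Q) i \<bullet> (\<mu> \<cdot>\<^sub>v col Q 0)"
      using that W(1) Qc(1) by (simp add: M_def assoc_mult_mat[of _ ?n ?n _ ?n _ ?n])
    also have "\<dots> = \<mu> * (mat_adjoint Q * Q) $$ (i, 0)"
      using that Qc(1) by (simp add: scalar_prod_smult_right)
    also have "\<dots> = (if i = 0 then \<mu> else 0)"
      using that by (simp add: Qc(3))
    finally show ?thesis .
  qed
  \<comment> \<open>Row 0 of the identity \<open>mat_adjoint M * M = 1\<^sub>m ?n\<close>: by
    \<open>col0\<close> only the term \<open>k = 0\<close> survives. The case \<open>j = 0\<close>
    shows that \<open>\<mu>\<close> is nonzero, so the remaining entries of the row vanish.\<close>
  have row: "cnj \<mu> * M $$ (0, j) = (if j = 0 then 1 else 0)" if "j < ?n" for j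
  proof -
    have "(if j = 0 then 1 else 0) = (mat_adjoint M * M) $$ (0, j)"
      using that by (auto simp: Mc(3))
    also have "\<dots> = (\<Sum>k<?n. cnj (M $$ (k, 0)) * M $$ (k, j))"
      using that Mc(1) by (simp add: scalar_prod_def lessThan_atLeast0 del: sum.op_ivl_Suc)
    also have "\<dots> = cnj \<mu> * M $$ (0, j)"
      unfolding sum.lessThan_Suc_shift by (simp add: col0)
    finally show ?thesis by simp
  qed
  have row0: "M $$ (0, j) = 0" if "j < ?n" "j \<noteq> 0" for j
    using row[of 0] row[OF that(1)] that(2) by auto
  define W1 where "W1 = mat n n (\<lambda>(i, j). M $$ (Suc i, Suc j))"
  have W1: "W1 \<in> carrier_mat n n"
    by (simp add: W1_def)
  have M_eq: "M = border \<mu> W1"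
    using Mc(1) by (intro eq_matI) (auto simp: index_border col0 row0 W1_def)
  with M have "W1 \<in> unitary_group n"
    using unitary_group_border_iff[OF W1] by simp
  then obtain V1 d where V1: "V1 \<in> unitary_group n" and W1d: "W1 = V1 * mat_diag n d * mat_adjoint V1"
    using Suc.IH by blast
  note V1c = unitary_groupD[OF V1]
  define B where "B = border 1 V1"
  have B: "B \<in> unitary_group ?n"
    unfolding B_def using V1 unitary_group_border_iff[OF V1c(1), of 1] by simp
  note Bc = unitary_groupD[OF B]
  \<comment> \<open>\<open>border\<close> respects products and adjoints, so the diagonalisation of
    \<open>W1\<close> lifts, with \<open>\<mu>\<close> inserted at index 0.\<close>
  have M_diag: "M = B * mat_diag ?n (case_nat \<mu> d) * mat_adjoint B"
    unfolding M_eq W1d B_def border_mat_diag[symmetric] using V1c(1)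
    by (simp add: border_adjoint border_mult[of _ n])
  have "W = Q * M * mat_adjoint Q"
    unfolding M_def using W(1) Qc(1) unitary_cancel[OF Q]
    by (simp add: assoc_mult_mat[of _ ?n ?n _ ?n _ ?n] Qc(2))
  also have "\<dots> = (Q * B) * mat_diag ?n (case_nat \<mu> d) * mat_adjoint (Q * B)"
    unfolding M_diag using Qc(1) Bc(1)
    by (simp add: assoc_mult_mat[of _ ?n ?n _ ?n _ ?n] mat_adjoint_mult[of _ ?n ?n _ ?n])
  finally show ?case
    by (rule Suc.prems(1)[OF unitary_group_mult[OF Q B]])
qed

section \<open>Functional calculus in a fixed eigenbasis\<close>

text \<open>For a fixed unitary \<open>V\<close> this is a functional calculus: adjoints, products,
  powers and exponentials are computed pointwise on \<open>d\<close>.\<close>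

definition spectral_mat :: "complex mat \<Rightarrow> (nat \<Rightarrow> complex) \<Rightarrow> complex mat" where
  "spectral_mat V d = V * mat_diag (dim_row V) d * mat_adjoint V"

context
  fixes V :: "complex mat" and N :: nat
  assumes V: "V \<in> unitary_group N"
begin

lemma spectral_mat_carrier [simp]: "spectral_mat V d \<in> carrier_mat N N"
  using unitary_groupD(1)[OF V] by (auto simp: spectral_mat_def)

lemma dim_spectral_mat [simp]: "dim_row (spectral_mat V d) = N" "dim_col (spectral_mat V d) = N"
  using carrier_matD[OF spectral_mat_carrier] by auto

text \<open>Each entry is linear in \<open>d\<close> and involves only its values below
  \<open>N\<close>, so functions agreeing there give the same matrix.\<close>

lemma index_spectral_mat:
  assumes "i < N" "j < N"
  shows "spectral_mat V d $$ (i, j) = (\<Sum>k<N. V $$ (i, k) * d k * cnj (V $$ (j, k)))"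
  using unitary_groupD(1)[OF V] assms
  by (auto simp: spectral_mat_def mat_diag_mult_right[of _ N N] scalar_prod_def lessThan_atLeast0
      intro!: sum.cong)

lemma spectral_mat_adjoint: "mat_adjoint (spectral_mat V d) = spectral_mat V (\<lambda>k. cnj (d k))"
  by (rule eq_matI) (auto simp: index_spectral_mat ac_simps)

lemma spectral_mat_uminus: "- spectral_mat V d = spectral_mat V (\<lambda>k. - d k)"
  by (rule eq_matI) (auto simp: index_spectral_mat sum_negf)

lemma spectral_mat_smult: "a \<cdot>\<^sub>m spectral_mat V d = spectral_mat V (\<lambda>k. a * d k)"
  by (rule eq_matI) (auto simp: index_spectral_mat sum_distrib_left ac_simps)

lemma spectral_mat_mult: "spectral_mat V d * spectral_mat V e = spectral_mat V (\<lambda>k. d k * e k)"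
proof -
  note Vc = unitary_groupD[OF V]
  have "spectral_mat V d * spectral_mat V e
      = V * (mat_diag N d * (mat_adjoint V * (V * (mat_diag N e * mat_adjoint V))))"
    using Vc(1) by (simp add: spectral_mat_def assoc_mult_mat[of _ N N _ N _ N])
  also have "\<dots> = V * (mat_diag N d * mat_diag N e) * mat_adjoint V"
    using Vc(1) by (simp add: unitary_cancel[OF V, of _ N] assoc_mult_mat[of _ N N _ N _ N] del: mat_diag_diag)
  finally show ?thesis
    using Vc(1) by (simp add: spectral_mat_def)
qed

lemma spectral_mat_one: "spectral_mat V (\<lambda>_. 1) = 1\<^sub>m N"
  using unitary_groupD[OF V] by (simp add: spectral_mat_def)

lemma spectral_mat_pow: "spectral_mat V d ^\<^sub>m k = spectral_mat V (\<lambda>l. d l ^ k)"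
  by (induction k) (simp_all add: spectral_mat_one spectral_mat_mult mult.commute)

text \<open>Each entry is a finite linear combination of scalar exponential series at the
  \<open>d l\<close>, so the limit passes through the sum over \<open>l\<close>.\<close>

lemma mat_exp_spectral_mat: "mat_exp (spectral_mat V d) = spectral_mat V (\<lambda>k. exp (d k))"
proof (rule eq_matI)
  fix i j assume "i < dim_row (spectral_mat V (\<lambda>k. exp (d k)))" "j < dim_col (spectral_mat V (\<lambda>k. exp (d k)))"
  then have ij: "i < N" "j < N"
    by auto
  have "(\<lambda>k. \<Sum>l<N. V $$ (i, l) * (d l ^ k /\<^sub>R fact k) * cnj (V $$ (j, l)))
      sums (\<Sum>l<N. V $$ (i, l) * exp (d l) * cnj (V $$ (j, l)))"
    by (intro sums_sum sums_mult sums_mult2 exp_converges)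
  also have "(\<lambda>k. \<Sum>l<N. V $$ (i, l) * (d l ^ k /\<^sub>R fact k) * cnj (V $$ (j, l)))
      = (\<lambda>k. (spectral_mat V d ^\<^sub>m k) $$ (i, j) / fact k)"
    using ij by (simp add: spectral_mat_pow index_spectral_mat sum_divide_distrib scaleR_conv_of_real
        field_simps of_real_inverse)
  finally show "mat_exp (spectral_mat V d) $$ (i, j) = spectral_mat V (\<lambda>k. exp (d k)) $$ (i, j)"
    using ij by (simp add: mat_exp_def index_spectral_mat sums_iff)
qed (auto simp: mat_exp_def)

text \<open>Conjugating back by \<open>V\<close> makes the diagonal matrix itself unitary, and its
  diagonal entries can then be read off.\<close>

lemma unitary_spectral_mat:
  assumes "spectral_mat V d \<in> unitary_group N" "k < N"
  shows "cmod (d k) = 1"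
proof -
  note Vc = unitary_groupD[OF V]
  define D where "D = mat_adjoint V * spectral_mat V d * V"
  have "D \<in> unitary_group N"
    unfolding D_def by (intro unitary_group_mult unitary_group_adjoint V assms)
  moreover have "D = mat_diag N d"
    unfolding D_def spectral_mat_def using Vc(1)
    by (simp add: unitary_cancel[OF V, of _ N] assoc_mult_mat[of _ N N _ N _ N] Vc(3) right_mult_one_mat[of _ N N])
  moreover have "mat_adjoint (mat_diag N d) = mat_diag N (\<lambda>k. cnj (d k))"
    by (rule eq_matI) (auto simp: mat_diag_def)
  ultimately have "mat_diag N (\<lambda>k. cnj (d k) * d k) = 1\<^sub>m N"
    using unitary_groupD(3) by fastforce
  from arg_cong[OF this, of "\<lambda>M. M $$ (k, k)"] have "cnj (d k) * d k = 1"
    using assms(2) by (simp add: mat_diag_def)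
  then show ?thesis
    by (metis cmod_power2 complex_mod_cnj norm_mult norm_one power2_eq_square abs_norm_cancel
        real_sqrt_abs real_sqrt_one)
qed

text \<open>Column \<open>k\<close> of \<open>V\<close> is an eigenvector; it is nonzero because
  \<open>mat_adjoint V * V\<close> has diagonal entry 1. This transfers the hypothesis on negative
  eigenvalues to the function \<open>d\<close>.\<close>

lemma eigenvalue_spectral_mat:
  assumes "k < N"
  shows "eigenvalue (spectral_mat V d) (d k)"
proof -
  note Vc = unitary_groupD[OF V]
  have "spectral_mat V d * V = V * mat_diag N d"
    using Vc(1) by (simp add: spectral_mat_def Vc(3) right_mult_one_mat[of _ N N] assoc_mult_mat[of _ N N _ N _ N])
  then have "spectral_mat V d *\<^sub>v col V k = col (V * mat_diag N d) k"
    using assms Vc(1) by (metis col_mult2 spectral_mat_carrier)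
  also have "\<dots> = d k \<cdot>\<^sub>v col V k"
    using assms Vc(1) by (intro eq_vecI) (auto simp: mat_diag_mult_right[of _ N N])
  finally have "spectral_mat V d *\<^sub>v col V k = d k \<cdot>\<^sub>v col V k" .
  moreover have "col V k \<noteq> 0\<^sub>v N"
  proof
    assume 0: "col V k = 0\<^sub>v N"
    have "(mat_adjoint V * V) $$ (k, k) = row (mat_adjoint V) k \<bullet> col V k"
      using assms Vc(1) by simp
    then show False
      using 0 assms Vc by simp
  qed
  ultimately show ?thesis
    using Vc(1) unfolding eigenvalue_def eigenvector_def by (intro exI[of _ "col V k"]) auto
qed

text \<open>In the two eigenbases, intertwining becomes
  \<open>C * mat_diag N d = mat_diag N e * C\<close>, compared entry by entry. Two bases are allowed
  so that the same criterion covers uniqueness of the logarithm (\<open>X\<close> the identity) and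
  its behaviour under conjugation (\<open>X = U\<close>).\<close>

lemma spectral_mat_intertwine_iff:
  assumes "V' \<in> unitary_group N" "X \<in> carrier_mat N N"
  defines "C \<equiv> mat_adjoint V' * X * V"
  shows "X * spectral_mat V d = spectral_mat V' e * X \<longleftrightarrow> (\<forall>i<N. \<forall>j<N. C $$ (i, j) * d j = e i * C $$ (i, j))"
proof -
  note Vc = unitary_groupD[OF V] and V'c = unitary_groupD[OF assms(1)]
  note [simp] = assoc_mult_mat[of _ N N _ N _ N] unitary_cancel[OF V, of _ N] unitary_cancel[OF assms(1), of _ N]
  have C: "C \<in> carrier_mat N N"
    using Vc(1) V'c(1) assms(2) by (simp add: C_def)
  have "X * spectral_mat V d = V' * (C * mat_diag N d) * mat_adjoint V"
    using Vc(1) V'c(1) assms(2) by (simp add: C_def spectral_mat_def)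
  moreover have "spectral_mat V' e * X = V' * (mat_diag N e * C) * mat_adjoint V"
    using Vc V'c(1) assms(2) by (simp add: C_def spectral_mat_def)
  \<comment> \<open>The change of bases is invertible, so the outer factors can be cancelled from an
    equation.\<close>
  moreover have "mat_adjoint V' * (V' * A * mat_adjoint V) * V = A" if "A \<in> carrier_mat N N" for A
    using that Vc V'c(1) by simp
  ultimately have "X * spectral_mat V d = spectral_mat V' e * X \<longleftrightarrow> C * mat_diag N d = mat_diag N e * C"
    using C by (metis mult_carrier_mat mat_diag_dim)
  also have "\<dots> \<longleftrightarrow> (\<forall>i<N. \<forall>j<N. C $$ (i, j) * d j = e i * C $$ (i, j))"
    using C by (auto simp: mat_diag_mult_right[of _ N N] mat_diag_mult_left[of _ N N] mat_eq_iff)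
  finally show ?thesis .
qed

end

section \<open>The principal logarithm\<close>

text \<open>On the open interval, \<open>Arg\<close> recovers the angle from
  \<open>cis\<close>.\<close>

lemma exp_ii_inj:
  fixes s t :: real
  assumes "exp (\<i> * s) = exp (\<i> * t)" "- pi < s" "s < pi" "- pi < t" "t < pi"
  shows "s = t"
proof -
  have "Arg (cis s) = s" "Arg (cis t) = t"
    using assms by (auto intro!: cis_Arg_unique simp: sgn_cis)
  then show ?thesis
    using assms(1) by (simp add: cis_conv_exp)
qed

text \<open>A matrix intertwining two unitaries also intertwines their logarithms: in eigenbases its
  nonzero entries only link equal eigenvalues, hence equal angles.\<close>

lemma spectral_mat_log_intertwine:
  fixes s t :: "nat \<Rightarrow> real"
  assumes V: "V \<in> unitary_group N" "V' \<in> unitary_group N" and X: "X \<in> carrier_mat N N"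
    and s: "\<And>k. k < N \<Longrightarrow> - pi < s k \<and> s k < pi" and t: "\<And>k. k < N \<Longrightarrow> - pi < t k \<and> t k < pi"
    and eq: "X * spectral_mat V (\<lambda>k. exp (\<i> * t k)) = spectral_mat V' (\<lambda>k. exp (\<i> * s k)) * X"
  shows "X * spectral_mat V (\<lambda>k. \<i> * t k) = spectral_mat V' (\<lambda>k. \<i> * s k) * X"
  unfolding spectral_mat_intertwine_iff[OF V X]
proof (intro allI impI)
  fix i j assume ij: "i < N" "j < N"
  let ?c = "(mat_adjoint V' * X * V) $$ (i, j)"
  have "?c * exp (\<i> * t j) = exp (\<i> * s i) * ?c"
    using eq ij unfolding spectral_mat_intertwine_iff[OF V X] by blast
  then have "?c = 0 \<or> t j = s i"
    using exp_ii_inj[of "t j" "s i"] s[OF ij(1)] t[OF ij(2)] by auto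
  then show "?c * (\<i> * t j) = \<i> * s i * ?c"
    by auto
qed

text \<open>Makes the definite description computable: any diagonalisation with admissible angles
  yields the logarithm.\<close>

lemma principal_log_spectral_mat:
  fixes t :: "nat \<Rightarrow> real"
  assumes V: "V \<in> unitary_group N" and t: "\<And>k. k < N \<Longrightarrow> - pi < t k \<and> t k < pi"
  shows "principal_log (spectral_mat V (\<lambda>k. exp (\<i> * t k))) = spectral_mat V (\<lambda>k. \<i> * t k)"
    (is "principal_log ?W = _")
  unfolding principal_log_def
proof (rule the_equality, goal_cases)
  case 1
  then show ?case
    using V t unitary_groupD(1)[OF V]
    by (intro exI[of _ V] exI[of _ t]) (simp add: dim_spectral_mat[OF V], simp add: spectral_mat_def)
next
  case (2 L)
  then obtain V' s where V': "V' \<in> unitary_group N" and s: "\<forall>j<N. - pi < s j \<and> s j < pi"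
    and W: "?W = V' * mat_diag N (\<lambda>j. exp (\<i> * complex_of_real (s j))) * mat_adjoint V'"
    and L: "L = V' * mat_diag N (\<lambda>j. \<i> * complex_of_real (s j)) * mat_adjoint V'"
    unfolding dim_spectral_mat[OF V] by blast
  note d = unitary_groupD(1)[OF V', THEN carrier_matD(1)]
  have W': "?W = spectral_mat V' (\<lambda>j. exp (\<i> * s j))" and L': "L = spectral_mat V' (\<lambda>j. \<i> * s j)"
    using W L d by (simp_all add: spectral_mat_def)
  \<comment> \<open>Two diagonalisations of the same matrix are intertwined by the identity, so
    their logarithms are as well, which means that they coincide.\<close>
  have "1\<^sub>m N * ?W = spectral_mat V' (\<lambda>j. exp (\<i> * s j)) * 1\<^sub>m N"
    unfolding W' left_mult_one_mat[OF spectral_mat_carrier[OF V']] right_mult_one_mat[OF spectral_mat_carrier[OF V']] ..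
  from spectral_mat_log_intertwine[OF V V' _ _ _ this] s t
  have "1\<^sub>m N * spectral_mat V (\<lambda>k. \<i> * t k) = spectral_mat V' (\<lambda>k. \<i> * s k) * 1\<^sub>m N"
    by simp
  then show ?case
    using spectral_mat_carrier[OF V] spectral_mat_carrier[OF V'] L'
    by (metis left_mult_one_mat right_mult_one_mat)
qed

text \<open>The eigenvalues have modulus 1, so \<open>Arg\<close> supplies the angles. The only
  boundary value it can take is \<open>pi\<close>, which would give the excluded eigenvalue
  -1.\<close>

lemma unitary_log_angles:
  assumes W: "W \<in> unitary_group N"
    and neg: "\<not> (\<exists>r::real. r < 0 \<and> eigenvalue W (complex_of_real r))"
  obtains V and t :: "nat \<Rightarrow> real"
  where "V \<in> unitary_group N" "\<And>k. k < N \<Longrightarrow> - pi < t k \<and> t k < pi"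
    "W = spectral_mat V (\<lambda>k. exp (\<i> * t k))"
proof -
  obtain V d where V: "V \<in> unitary_group N" and Wd: "W = V * mat_diag N d * mat_adjoint V"
    using unitary_diagonalisation[OF W] by blast
  have Ws: "W = spectral_mat V d"
    using Wd unitary_groupD(1)[OF V] by (simp add: spectral_mat_def)
  have t: "- pi < Arg (d k) \<and> Arg (d k) < pi \<and> exp (\<i> * Arg (d k)) = d k" if "k < N" for k
  proof -
    have cm: "cmod (d k) = 1"
      using unitary_spectral_mat[OF V _ that] W Ws by simp
    then have "d k \<noteq> 0"
      by auto
    then have ex: "exp (\<i> * Arg (d k)) = d k"
      using cis_Arg[of "d k"] cm by (simp add: cis_conv_exp sgn_div_norm)
    have "Arg (d k) \<noteq> pi"
    proof
      assume "Arg (d k) = pi"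
      then have "d k = complex_of_real (-1)"
        using ex by (simp add: cis_pi flip: cis_conv_exp)
      then show False
        using neg[unfolded not_ex, rule_format, of "-1"] eigenvalue_spectral_mat[OF V that, of d] Ws by simp
    qed
    then show ?thesis
      using ex Arg_bounded[of "d k"] by auto
  qed
  have "W = spectral_mat V (\<lambda>k. exp (\<i> * Arg (d k)))"
    unfolding Ws using t by (intro eq_matI) (simp_all add: index_spectral_mat[OF V] dim_spectral_mat[OF V])
  with V t show ?thesis
    by (intro that[of V "\<lambda>k. Arg (d k)"]) auto
qed

section \<open>Commutation with the special unitary algebra\<close>

text \<open>Subtracting the scalar matrix with the same trace moves \<open>K\<close> into
  \<open>su N\<close>, and scalar matrices commute with everything.\<close>

lemma commute_of_commute_skew_traceless:
  assumes S: "S \<in> carrier_mat N N" and comm: "\<And>A. A \<in> su N \<Longrightarrow> S * A = A * S"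
    and K: "K \<in> carrier_mat N N" "mat_adjoint K = - K"
  shows "S * K = K * S"
\<comment> \<open>The mean \<open>c\<close> of the diagonal divides by \<open>N\<close>; matrices of
  size 0 have no entries to compare.\<close>
proof (cases "N = 0")
  case True
  then show ?thesis
    using S K by (intro eq_matI) auto
next
  case False
  define c where "c = mat_trace K / of_nat N"
  \<comment> \<open>The trace of a skew-Hermitian matrix is imaginary, so removing the multiple
    \<open>c\<close> of the identity keeps the matrix skew-Hermitian.\<close>
  have "cnj (mat_trace K) = - mat_trace K"
  proof -
    have "cnj (K $$ (i, i)) = - K $$ (i, i)" if "i < N" for i
      using arg_cong[OF K(2), of "\<lambda>M. M $$ (i, i)"] that K(1) by simp
    then show ?thesis
      using K(1) by (simp add: mat_trace_def sum_negf)
  qed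
  then have c: "cnj c = - c"
    by (simp add: c_def)
  define A where "A = K - c \<cdot>\<^sub>m 1\<^sub>m N"
  have A: "A \<in> carrier_mat N N"
    using K(1) by (simp add: A_def minus_carrier_mat)
  have "mat_adjoint A = - A"
  proof (rule eq_matI)
    fix i j assume "i < dim_row (- A)" "j < dim_col (- A)"
    then have ij: "i < N" "j < N"
      using A by auto
    have "cnj (K $$ (j, i)) = - K $$ (i, j)"
      using arg_cong[OF K(2), of "\<lambda>M. M $$ (i, j)"] ij K(1) by simp
    then show "mat_adjoint A $$ (i, j) = (- A) $$ (i, j)"
      using ij K(1) A c by (auto simp: A_def)
  qed (use A in auto)
  moreover have "mat_trace A = 0"
    using K(1) False by (simp add: mat_trace_def A_def sum_subtractf c_def)
  ultimately have "S * A = A * S"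
    using A by (intro comm) (simp add: su_def)
  moreover have "S * A = S * K - c \<cdot>\<^sub>m S" "A * S = K * S - c \<cdot>\<^sub>m S"
    using S K(1)
    by (simp_all add: A_def mult_minus_distrib_mat[of _ N N _ N] minus_mult_distrib_mat[of _ N N _ _ N]
        mult_smult_distrib[of _ N N _ N] mult_smult_assoc_mat[of _ N N _ N])
  ultimately have eq: "S * K - c \<cdot>\<^sub>m S = K * S - c \<cdot>\<^sub>m S"
    by simp
  show ?thesis
  proof (rule eq_matI)
    fix i j assume "i < dim_row (K * S)" "j < dim_col (K * S)"
    then show "(S * K) $$ (i, j) = (K * S) $$ (i, j)"
      using arg_cong[OF eq, of "\<lambda>M. M $$ (i, j)"] S K(1) by simp
  qed (use S K(1) in auto)
qed

text \<open>\<open>2 A = (A - A\<^sup>\<dagger>) - \<i> (\<i> (A + A\<^sup>\<dagger>))\<close> writes an arbitrary matrix in terms of two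
  skew-Hermitian ones.\<close>

lemma commute_of_commute_su:
  assumes S: "S \<in> carrier_mat N N" and comm: "\<And>A. A \<in> su N \<Longrightarrow> S * A = A * S"
    and A: "A \<in> carrier_mat N N"
  shows "S * A = A * S"
proof -
  let ?B = "mat_adjoint A"
  have B: "?B \<in> carrier_mat N N"
    using A by simp
  have sk1: "mat_adjoint (A - ?B) = - (A - ?B)"
    using A by (intro eq_matI) auto
  have sk2: "mat_adjoint (\<i> \<cdot>\<^sub>m (A + ?B)) = - (\<i> \<cdot>\<^sub>m (A + ?B))"
    using A by (intro eq_matI) (auto simp: algebra_simps)
  have "S * (A - ?B) = (A - ?B) * S"
    using A B by (intro commute_of_commute_skew_traceless[OF S comm _ sk1]) auto
  then have 1: "S * A - S * ?B = A * S - ?B * S"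
    using S A B by (simp add: mult_minus_distrib_mat[of _ N N _ N] minus_mult_distrib_mat[of _ N N _ _ N])
  have "S * (\<i> \<cdot>\<^sub>m (A + ?B)) = (\<i> \<cdot>\<^sub>m (A + ?B)) * S"
    using A B by (intro commute_of_commute_skew_traceless[OF S comm _ sk2]) auto
  then have 2: "\<i> \<cdot>\<^sub>m (S * A + S * ?B) = \<i> \<cdot>\<^sub>m (A * S + ?B * S)"
    using S A B by (simp add: mult_smult_distrib[of _ N N _ N] mult_smult_assoc_mat[of _ N N _ N]
        mult_add_distrib_mat[of _ N N _ N] add_mult_distrib_mat[of _ N N _ _ N])
  show ?thesis
  proof (rule eq_matI)
    fix i j assume "i < dim_row (A * S)" "j < dim_col (A * S)"
    then have ij: "i < N" "j < N"
      using A S by auto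
    have "(S * A) $$ (i, j) - (S * ?B) $$ (i, j) = (A * S) $$ (i, j) - (?B * S) $$ (i, j)"
      using arg_cong[OF 1, of "\<lambda>M. M $$ (i, j)"] ij S A B by (simp del: index_mult_mat(1))
    moreover have "(S * A) $$ (i, j) + (S * ?B) $$ (i, j) = (A * S) $$ (i, j) + (?B * S) $$ (i, j)"
      using arg_cong[OF 2, of "\<lambda>M. M $$ (i, j)"] ij S A B by (simp del: index_mult_mat(1))
    \<comment> \<open>Adding the two relations eliminates the terms that contain the
      adjoint.\<close>
    moreover have "a = c" if "a - b = c - d" "a + b = c + d" for a b c d :: complex
    proof -
      have "2 * a = (a - b) + (a + b)"
        by simp
      also have "\<dots> = (c - d) + (c + d)"
        unfolding that ..
      also have "\<dots> = 2 * c"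
        by simp
      finally show ?thesis
        by simp
    qed
    ultimately show "(S * A) $$ (i, j) = (A * S) $$ (i, j)"
      by blast
  qed (use A S in auto)
qed

text \<open>Both sides equal \<open>mat_adjoint G * (U * G)\<close> once \<open>U * U\<close> is
  moved past \<open>mat_adjoint G\<close>. The equation is phrased as an intertwining relation, the
  form in which it passes to logarithms.\<close>

lemma conj_by_cartan_element:
  assumes U: "U \<in> unitary_group N" and G: "G \<in> unitary_group N"
    and inv: "\<And>A. A \<in> su N \<Longrightarrow> conj_by U (conj_by U A) = A"
  shows "U * (conj_by U (mat_adjoint G) * G) = mat_adjoint (conj_by U (mat_adjoint G) * G) * U"
proof -
  note Uc = unitary_groupD[OF U] and Gc = unitary_groupD[OF G]
  note [simp] = assoc_mult_mat[of _ N N _ N _ N] unitary_cancel[OF U, of _ N] mat_adjoint_mult[of _ N N _ N]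
  have comm: "U * U * A = A * (U * U)" if "A \<in> su N" for A
  proof -
    have A: "A \<in> carrier_mat N N"
      using that by (simp add: su_def)
    have "conj_by U (conj_by U A) * (U * U) = U * (U * A)"
      using Uc A unitary_cancel[OF unitary_group_mult[OF U U], of A N]
      by (simp add: conj_by_def)
    then show ?thesis
      using inv[OF that] Uc(1) A by simp
  qed
  \<comment> \<open>\<open>mat_adjoint G\<close> is a group element rather than a member of
    \<open>su N\<close>, so commutation is first extended to all matrices.\<close>
  have sq: "U * U * mat_adjoint G = mat_adjoint G * (U * U)"
    by (rule commute_of_commute_su[OF square_mult_carrier[OF Uc(1) Uc(1)] comm mat_adjoint_carrier[OF Gc(1)]])
  have "U * (conj_by U (mat_adjoint G) * G) = (U * U * mat_adjoint G) * (mat_adjoint U * G)"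
    using Uc(1) Gc(1) by (simp add: conj_by_def)
  also have "\<dots> = mat_adjoint G * (U * G)"
    unfolding sq using Uc(1) Gc(1) by simp
  also have "\<dots> = mat_adjoint (conj_by U (mat_adjoint G) * G) * U"
    using Uc Gc(1) by (simp add: conj_by_def)
  finally show ?thesis .
qed

section \<open>Membership of the halved logarithm in the minus eigenspace\<close>

theorem proposition9:
  fixes n :: nat and U G :: "complex mat"
  assumes "n \<ge> 1"
    and "U \<in> SU (2 ^ n)"
    and "orthogonal_symmetric_lie_algebra (2 ^ n) (su (2 ^ n)) (conj_by U)"
    and "G \<in> SU (2 ^ n)"
    and "\<not> (\<exists>r::real. r < 0 \<and> eigenvalue (conj_by U (mat_adjoint G) * G) (complex_of_real r))"
  shows "let m = (1/2) \<cdot>\<^sub>m principal_log (conj_by U (mat_adjoint G) * G) in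
           m \<in> minus_eigenspace (su (2 ^ n)) (conj_by U) \<and>
           mat_exp (2 \<cdot>\<^sub>m m) = conj_by U (mat_adjoint G) * G"
proof -
  define N where "N = (2 ^ n :: nat)"
  define W where "W = conj_by U (mat_adjoint G) * G"
  have U: "U \<in> unitary_group N" and G: "G \<in> unitary_group N"
    using assms(2,4) by (auto simp: SU_def N_def)
  note Uc = unitary_groupD[OF U]
  have W: "W \<in> unitary_group N"
    unfolding W_def conj_by_def by (intro unitary_group_mult unitary_group_adjoint U G)
  obtain V t where V: "V \<in> unitary_group N" and t: "\<And>k. k < N \<Longrightarrow> - pi < t k \<and> t k < pi"
    and Wt: "W = spectral_mat V (\<lambda>k. exp (\<i> * complex_of_real (t k)))"
    using unitary_log_angles[OF W] assms(5) unfolding W_def by metis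
  note [simp] = dim_spectral_mat[OF V] spectral_mat_carrier[OF V]
  have log: "principal_log W = spectral_mat V (\<lambda>k. \<i> * t k)"
    unfolding Wt by (rule principal_log_spectral_mat[OF V t])
  have log_carrier: "principal_log W \<in> carrier_mat N N"
    by (simp add: log)
  have smult_uminus: "- ((1/2) \<cdot>\<^sub>m principal_log W) = (1/2) \<cdot>\<^sub>m (- principal_log W)"
    using log_carrier by (intro eq_matI) auto
  define m where "m = (1/2) \<cdot>\<^sub>m principal_log W"
  have m: "m = spectral_mat V (\<lambda>k. 1/2 * (\<i> * t k))"
    unfolding m_def log by (rule spectral_mat_smult[OF V])
  have mc: "m \<in> carrier_mat N N"
    by (simp add: m)
  have exp_m: "mat_exp (2 \<cdot>\<^sub>m m) = W"
    by (simp add: m spectral_mat_smult[OF V] mat_exp_spectral_mat[OF V] Wt)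
  have skew: "mat_adjoint m = - m"
    by (simp add: m spectral_mat_adjoint[OF V] spectral_mat_uminus[OF V])
  \<comment> \<open>The range of admissible angles is symmetric about 0, so negating
    \<open>t\<close> gives admissible angles for the adjoint in the same eigenbasis.\<close>
  have Wadj: "mat_adjoint W = spectral_mat V (\<lambda>k. exp (\<i> * complex_of_real (- t k)))"
    using cis_cnj by (simp add: Wt spectral_mat_adjoint[OF V] cis_conv_exp del: cis_cnj)
  have "U * W = mat_adjoint W * U"
    unfolding W_def using assms(3)
    by (intro conj_by_cartan_element[OF U G])
       (auto simp: orthogonal_symmetric_lie_algebra_def involutive_on_def N_def)
  \<comment> \<open>Here \<open>U\<close> is the intertwiner, \<open>V\<close> serves as both
    eigenbases, and the angles on the right are the negated ones.\<close>
  then have "U * spectral_mat V (\<lambda>k. \<i> * t k)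
      = spectral_mat V (\<lambda>k. \<i> * complex_of_real (- t k)) * U"
    unfolding Wadj unfolding Wt
    by (rule spectral_mat_log_intertwine[OF V V Uc(1), rotated 2]) (use t in force)+
  also have "spectral_mat V (\<lambda>k. \<i> * complex_of_real (- t k)) = - principal_log W"
    by (simp add: log spectral_mat_uminus[OF V])
  finally have "U * principal_log W = - principal_log W * U"
    by (simp add: log)
  then have Um: "U * m = - m * U"
    using Uc(1) by (simp add: m_def log_carrier mult_smult_distrib[of _ N N _ N] mult_smult_assoc_mat[of _ N N _ N]
        smult_uminus)
  have minus: "conj_by U m = - m"
    using Uc mc by (simp add: conj_by_def Um assoc_mult_mat[of _ N N _ N _ N])
  \<comment> \<open>Cyclicity brings \<open>mat_adjoint U\<close> next to \<open>U\<close>, where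
    they cancel; with \<open>minus\<close> this makes the trace equal to its own negative.\<close>
  have "mat_trace (conj_by U m) = mat_trace (mat_adjoint U * (U * m))"
    unfolding conj_by_def using Uc(1) mc by (intro mat_trace_comm[of _ N]) auto
  then have "mat_trace (- m) = mat_trace m"
    using unitary_cancel(1)[OF U mc] minus by simp
  moreover have "mat_trace (- m) = - mat_trace m"
    using mc by (simp add: mat_trace_def sum_negf)
  ultimately have "mat_trace m = 0"
    by simp
  with mc skew minus exp_m show ?thesis
    unfolding Let_def m_def[symmetric] W_def[symmetric] N_def[symmetric]
    by (simp add: minus_eigenspace_def su_def)
qed

end
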